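(* Let $\varphi(z)=1+B_1z+B_2z^2+\cdots$ be as in the context. If $f\in\mathcal{C}_s(\varphi)$ and $B_1\le\lvert B_2\rvert$, then $$T_{3,1}(f)\le 1.$$ The result is sharp, i.e. equality holds for some $f\in\mathcal{C}_s(\varphi)$.
   Context: $\mathbb{D}$ is the open unit disk in $\mathbb{C}$, and $\mathcal{A}$ is the class of holomorphic functions $f$ on $\mathbb{D}$ with $f(0)=f'(0)-1=0$. The function $\varphi$ is analytic and univalent in $\mathbb{D}$ with $\varphi(0)=1$, $\operatorname{Re}\varphi(z)>0$ on $\mathbb{D}$, $\varphi(\mathbb{D})$ starlike with respect to $\varphi(0)=1$ and symmetric with respect to the real axis, and $\varphi(z)=1+B_1z+B_2z^2+\cdots$ with $B_1>0$ (so all $B_n$ are real). The symbol $\prec$ denotes subordination: $g\prec\varphi$ means $g=\varphi\circ\omega$ for some analytic $\omega:\mathbb{D}\to\mathbb{D}$ with $\omega(0)=0$. The class $\mathcal{C}_s(\varphi)$ consists of all $f\in\mathcal{A}$ such that $\dfrac{(2zf'(z))'}{(f(z)-f(-z))'}\prec\varphi(z)$. For $f(z)=z+a_2z^2+a_3z^3+\cdots\in\mathcal{A}$, the third order Hermitian-Toeplitz determinant is $T_{3,1}(f)=1-2\lvert a_2\rvert^2+2\operatorname{Re}(a_2^2\overline{a_3})-\lvert a_3\rvert^2$. *)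

theory Defs
  imports "HOL-Complex_Analysis.Complex_Analysis"
begin

abbreviation unit_disk :: "complex set" where
  "unit_disk \<equiv> ball 0 1"

abbreviation taylor_coeff :: "(complex \<Rightarrow> complex) \<Rightarrow> nat \<Rightarrow> complex" where
  "taylor_coeff f n \<equiv> fps_nth (fps_expansion f 0) n"

definition class_A :: "(complex \<Rightarrow> complex) set" where
  "class_A = {f. f holomorphic_on unit_disk \<and> f 0 = 0 \<and> deriv f 0 - 1 = 0}"

definition subordinate :: "(complex \<Rightarrow> complex) \<Rightarrow> (complex \<Rightarrow> complex) \<Rightarrow> bool" where
  "subordinate g \<phi> \<longleftrightarrow>
     (\<exists>\<omega>. \<omega> holomorphic_on unit_disk \<and> \<omega> ` unit_disk \<subseteq> unit_disk \<and> \<omega> 0 = 0 \<and>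
          (\<forall>z\<in>unit_disk. g z = \<phi> (\<omega> z)))"

(* The library predicate starlike leaves the centre existentially quantified. *)
definition starlike_wrt :: "complex \<Rightarrow> complex set \<Rightarrow> bool" where
  "starlike_wrt a S \<longleftrightarrow> a \<in> S \<and> (\<forall>x\<in>S. closed_segment a x \<subseteq> S)"

(* The last two conjuncts say B_1 > 0 for the (complex) coefficient B_1. *)
definition admissible :: "(complex \<Rightarrow> complex) \<Rightarrow> bool" where
  "admissible \<phi> \<longleftrightarrow>
     \<phi> holomorphic_on unit_disk \<and> inj_on \<phi> unit_disk \<and> \<phi> 0 = 1 \<and>
     (\<forall>z\<in>unit_disk. Re (\<phi> z) > 0) \<and>
     starlike_wrt (\<phi> 0) (\<phi> ` unit_disk) \<and>
     cnj ` (\<phi> ` unit_disk) = \<phi> ` unit_disk \<and>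
     taylor_coeff \<phi> 1 \<in> \<real> \<and> Re (taylor_coeff \<phi> 1) > 0"

(* Division by zero yields 0 here, but for an admissible \<phi> the function \<phi> has no zero in the
   disk, so membership forces (f(z) - f(-z))' to be nonzero throughout the disk. *)
definition class_C_s :: "(complex \<Rightarrow> complex) \<Rightarrow> (complex \<Rightarrow> complex) set" where
  "class_C_s \<phi> = {f \<in> class_A.
     subordinate (\<lambda>z. deriv (\<lambda>w. 2 * w * deriv f w) z / deriv (\<lambda>w. f w - f (- w)) z) \<phi>}"

definition T31 :: "(complex \<Rightarrow> complex) \<Rightarrow> real" where
  "T31 f = (let a2 = taylor_coeff f 2; a3 = taylor_coeff f 3 in
     1 - 2 * (cmod a2)\<^sup>2 + 2 * Re (a2\<^sup>2 * cnj a3) - (cmod a3)\<^sup>2)"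

end

theory Submission
  imports Defs
begin

text \<open>
  Write \<open>x = \<bar>a\<^sub>2\<bar>\<^sup>2\<close> and \<open>y = \<bar>a\<^sub>3\<bar>\<close>. Since \<open>Re (a\<^sub>2\<^sup>2 cnj a\<^sub>3) \<le> x y\<close>, the bound on the determinant
  follows from \<open>2 x y \<le> 2 x + y\<^sup>2\<close>. As a quadratic in \<open>y\<close> this has discriminant \<open>4 x (x - 2)\<close>, so it
  holds for every \<open>y\<close> once \<open>0 \<le> x \<le> 2\<close> (\<open>hermitian_toeplitz_le_one\<close>): the second coefficient
  alone has to be controlled.

  For \<open>f\<close> in the class, the quotient \<open>p(z) = (2 z f'(z))' / (f(z) - f(-z))' = 1 + 4 a\<^sub>2 z + \<dots>\<close> is
  subordinate to \<open>\<phi>\<close> and therefore has positive real part. Caratheodory's bound \<open>\<bar>p'(0)\<bar> \<le> 2\<close>, which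
  is the Schwarz lemma for the Cayley transform of \<open>p\<close>, gives \<open>\<bar>a\<^sub>2\<bar> \<le> 1/2\<close>
  (\<open>class_C_s_second_coeff_bound\<close>), more than enough.

  Equality is attained by the identity, for which \<open>a\<^sub>2 = a\<^sub>3 = 0\<close> and \<open>p = 1\<close>.
\<close>

text \<open>
  The Cayley transform \<open>w \<mapsto> (w - 1) / (w + 1)\<close> maps the right half-plane to the unit disk and
  sends \<open>1\<close> to \<open>0\<close> with derivative \<open>1/2\<close> there; the Schwarz lemma bounds the derivative of the
  composition by \<open>1\<close>.
\<close>

lemma Caratheodory_deriv_bound:
  assumes hol: "p holomorphic_on ball 0 1" and p0: "p 0 = 1"
    and pos: "\<And>z. z \<in> ball 0 1 \<Longrightarrow> Re (p z) > 0"
  shows "cmod (deriv p 0) \<le> 2"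
proof -
  define g where "g = (\<lambda>z. (p z - 1) / (p z + 1))"
  have nz: "p z + 1 \<noteq> 0" if "z \<in> ball 0 1" for z
    using pos[OF that] by (auto simp: complex_eq_iff)
  have g_hol: "g holomorphic_on ball 0 1"
    unfolding g_def using nz by (intro holomorphic_intros hol) auto
  have g_bound: "cmod (g z) < 1" if "cmod z < 1" for z
  proof -
    have z: "z \<in> ball 0 1" using that by simp
    have "(cmod (p z - 1))\<^sup>2 < (cmod (p z + 1))\<^sup>2"
      using pos[OF z] unfolding cmod_power2 by (simp add: power2_eq_square algebra_simps)
    then have "cmod (p z - 1) < cmod (p z + 1)"
      by (rule power2_less_imp_less) simp
    then show ?thesis
      using nz[OF z] by (simp add: g_def norm_divide)
  qed
  have "g 0 = 0" by (simp add: g_def p0)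
  then have "cmod (deriv g 0) \<le> 1"
    using Schwarz_Lemma(2)[of g 0] g_hol g_bound by auto
  moreover have "(p has_field_derivative deriv p 0) (at 0)"
    using hol by (intro holomorphic_derivI[where S = "ball 0 1"]) auto
  then have "(g has_field_derivative deriv p 0 / 2) (at 0)"
    unfolding g_def
    by (auto intro!: derivative_eq_intros simp: p0)
  then have "deriv g 0 = deriv p 0 / 2"
    by (rule DERIV_imp_deriv)
  ultimately show ?thesis
    by (simp add: norm_divide)
qed

text \<open>
  The defining quotient has derivative \<open>2 f''(0) = 4 a\<^sub>2\<close> at the origin. It agrees on the disk with
  a function of positive real part, so Caratheodory's bound gives \<open>\<bar>4 a\<^sub>2\<bar> \<le> 2\<close>.
\<close>

lemma class_C_s_second_coeff_bound:
  assumes adm: "admissible \<phi>" and f: "f \<in> class_C_s \<phi>"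
  shows "cmod (taylor_coeff f 2) \<le> 1 / 2"
proof -
  define N where "N = deriv (\<lambda>w. 2 * w * deriv f w)"
  define D where "D = deriv (\<lambda>w. f w - f (- w))"
  have f_hol: "f holomorphic_on ball 0 1" and f'0: "deriv f 0 = 1"
    using f by (auto simp: class_C_s_def class_A_def)
  obtain \<omega> where \<omega>: "\<omega> holomorphic_on ball 0 1" "\<omega> ` ball 0 1 \<subseteq> ball 0 1" "\<omega> 0 = 0"
    and quot: "\<And>z. z \<in> ball 0 1 \<Longrightarrow> N z / D z = \<phi> (\<omega> z)"
    using f by (auto simp: class_C_s_def subordinate_def N_def D_def)
  have p_bound: "cmod (deriv (\<lambda>z. \<phi> (\<omega> z)) 0) \<le> 2"
  proof (rule Caratheodory_deriv_bound)
    show "(\<lambda>z. \<phi> (\<omega> z)) holomorphic_on ball 0 1"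
      using adm \<omega> holomorphic_on_compose_gen[of \<omega> "ball 0 1" \<phi> "ball 0 1"]
      by (auto simp: admissible_def o_def)
    show "\<phi> (\<omega> 0) = 1"
      using adm \<omega> by (simp add: admissible_def)
    show "Re (\<phi> (\<omega> z)) > 0" if "z \<in> ball 0 1" for z
      using adm \<omega>(2) that unfolding admissible_def by blast
  qed
  have f1_hol: "deriv f holomorphic_on ball 0 1"
    by (intro holomorphic_deriv f_hol) auto
  then have f2_hol: "deriv (deriv f) holomorphic_on ball 0 1"
    by (rule holomorphic_deriv) auto
  have df: "(f has_field_derivative deriv f z) (at z)" if "z \<in> ball 0 1" for z
    using that f_hol by (intro holomorphic_derivI[where S = "ball 0 1"]) auto
  have df1: "(deriv f has_field_derivative deriv (deriv f) z) (at z)" if "z \<in> ball 0 1" for z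
    using that f1_hol by (intro holomorphic_derivI[where S = "ball 0 1"]) auto
  have df2: "(deriv (deriv f) has_field_derivative deriv (deriv (deriv f)) 0) (at 0)"
    using f2_hol by (intro holomorphic_derivI[where S = "ball 0 1"]) auto
  have N_eq: "N z = 2 * deriv f z + 2 * z * deriv (deriv f) z" if "z \<in> ball 0 1" for z
    unfolding N_def using df1[OF that]
    by (intro DERIV_imp_deriv) (auto intro!: derivative_eq_intros)
  have D_eq: "D z = deriv f z + deriv f (- z)" if "z \<in> ball 0 1" for z
  proof -
    have "((\<lambda>w. f (- w)) has_field_derivative deriv f (- z) * (- 1)) (at z)"
      using that by (intro DERIV_chain2[of f] df) (auto intro!: derivative_eq_intros)
    then show ?thesis
      unfolding D_def using df[OF that]
      by (intro DERIV_imp_deriv) (auto intro!: derivative_eq_intros)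
  qed
  have dN: "((\<lambda>z. 2 * deriv f z + 2 * z * deriv (deriv f) z)
      has_field_derivative 4 * deriv (deriv f) 0) (at 0)"
    using df1[of 0] df2 by (auto intro!: derivative_eq_intros)
  \<comment> \<open>The denominator is even, so it does not contribute to the linear coefficient of the quotient.\<close>
  have dD: "((\<lambda>z. deriv f z + deriv f (- z)) has_field_derivative 0) (at 0)"
  proof -
    have "((\<lambda>w. deriv f (- w)) has_field_derivative deriv (deriv f) (- 0) * (- 1)) (at 0)"
      by (intro DERIV_chain2[of "deriv f"] df1) (auto intro!: derivative_eq_intros)
    then show ?thesis
      using df1[of 0] by (auto intro!: derivative_eq_intros)
  qed
  have dq: "((\<lambda>z. (2 * deriv f z + 2 * z * deriv (deriv f) z) / (deriv f z + deriv f (- z)))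
      has_field_derivative 2 * deriv (deriv f) 0) (at 0)"
    using DERIV_divide[OF dN dD] by (simp add: f'0)
  have "((\<lambda>z. \<phi> (\<omega> z)) has_field_derivative 2 * deriv (deriv f) 0) (at 0)"
    by (rule has_field_derivative_transform_within_open[OF dq, of "ball 0 1"])
      (use quot N_eq D_eq in \<open>auto simp: dist_norm\<close>)
  then have "deriv (\<lambda>z. \<phi> (\<omega> z)) 0 = 2 * deriv (deriv f) 0"
    by (rule DERIV_imp_deriv)
  then have "cmod (deriv (deriv f) 0) \<le> 1"
    using p_bound by (simp add: norm_mult)
  then show ?thesis
    by (simp add: fps_expansion_def numeral_2_eq_2 norm_divide)
qed

text \<open>
  Completing the square leaves \<open>2 x + y\<^sup>2 - 2 x y = (y - x)\<^sup>2 + x (2 - x)\<close> with \<open>x = \<bar>a\<bar>\<^sup>2\<close> and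
  \<open>y = \<bar>b\<bar>\<close>.
\<close>

lemma hermitian_toeplitz_le_one:
  fixes a b :: complex
  assumes "(cmod a)\<^sup>2 \<le> 2"
  shows "1 - 2 * (cmod a)\<^sup>2 + 2 * Re (a\<^sup>2 * cnj b) - (cmod b)\<^sup>2 \<le> 1"
proof -
  define x y where "x = (cmod a)\<^sup>2" and "y = cmod b"
  have "Re (a\<^sup>2 * cnj b) \<le> x * y"
    using complex_Re_le_cmod[of "a\<^sup>2 * cnj b"]
    by (simp add: x_def y_def norm_mult norm_power)
  moreover have "0 \<le> (y - x)\<^sup>2 + x * (2 - x)"
    using assms by (simp add: x_def)
  then have "2 * (x * y) \<le> 2 * x + y\<^sup>2"
    by (simp add: power2_eq_square algebra_simps)
  ultimately have "1 - 2 * x + 2 * Re (a\<^sup>2 * cnj b) - y\<^sup>2 \<le> 1"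
    by linarith
  then show ?thesis
    unfolding x_def y_def .
qed

lemma identity_in_class_C_s:
  assumes "admissible \<phi>"
  shows "(\<lambda>z. z) \<in> class_C_s \<phi>"
proof -
  have N: "deriv (\<lambda>w. 2 * w) z = 2" for z :: complex
    by (intro DERIV_imp_deriv) (auto intro!: derivative_eq_intros)
  have D: "deriv (\<lambda>w. w - - w) z = 2" for z :: complex
    by (intro DERIV_imp_deriv) (auto intro!: derivative_eq_intros)
  have "subordinate (\<lambda>z. 1) \<phi>"
    unfolding subordinate_def
    using assms by (intro exI[of _ "\<lambda>_. 0"]) (auto simp: admissible_def)
  then show ?thesis
    using N D by (simp add: class_C_s_def class_A_def)
qed

lemma T31_identity: "T31 (\<lambda>z. z) = 1"
proof -
  have "deriv (\<lambda>z :: complex. z) = (\<lambda>_. 1)"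
    by auto
  then show ?thesis
    by (simp add: T31_def fps_expansion_def numeral_2_eq_2 numeral_3_eq_3)
qed

theorem theorem3p2:
  fixes \<phi> :: "complex \<Rightarrow> complex"
  assumes "admissible \<phi>"
    and "Re (taylor_coeff \<phi> 1) \<le> cmod (taylor_coeff \<phi> 2)"
  shows "(\<forall>f\<in>class_C_s \<phi>. T31 f \<le> 1) \<and> (\<exists>f\<in>class_C_s \<phi>. T31 f = 1)"
proof
  show "\<forall>f\<in>class_C_s \<phi>. T31 f \<le> 1"
  proof
    fix f assume "f \<in> class_C_s \<phi>"
    then have "cmod (taylor_coeff f 2) \<le> 1 / 2"
      using assms(1) by (rule class_C_s_second_coeff_bound[rotated])
    then have "(cmod (taylor_coeff f 2))\<^sup>2 \<le> (1 / 2)\<^sup>2"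
      by (intro power_mono) auto
    then have "(cmod (taylor_coeff f 2))\<^sup>2 \<le> 2"
      by (simp add: power2_eq_square)
    then show "T31 f \<le> 1"
      unfolding T31_def Let_def by (rule hermitian_toeplitz_le_one)
  qed
  show "\<exists>f\<in>class_C_s \<phi>. T31 f = 1"
    using identity_in_class_C_s[OF assms(1)] T31_identity by blast
qed

end
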